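(* Let $P:\mathcal{A}\to\mathcal{X}$ be an ordered functor between ordered categories, and suppose that $\mathcal{X}$ has inserters. Then $P$ is strongly order-solid if and only if the following three conditions hold: (a) $P$ is solid as an ordinary functor; (b) $\mathcal{A}$ has inserters and $P$ preserves them; (c) $P$ is order-faithful.
   Context: An ordered category is a category whose hom-sets carry a partial order preserved by composition from either side; an ordered functor is a functor whose hom-maps are monotone. Let $P:\mathcal{A}\to\mathcal{X}$ be an ordered functor. For a (possibly empty, possibly proper-class-sized) family $D=(D_i)_{i\in I}$ of objects of $\mathcal{A}$, a family $\alpha:D\to A$ in $\mathcal{A}$ is a family of morphisms $\alpha_i:D_i\to A$ ($i\in I$); a family $\xi:PD\to X$ in $\mathcal{X}$ is a family of morphisms $\xi_i:PD_i\to X$. Equations such as $P\alpha=q\cdot\xi$ are meant componentwise: $P\alpha_i=q\cdot\xi_i$ for all $i\in I$. A morphism $q:X\to PA$ with $A\in\mathrm{ob}\,\mathcal{A}$ is order-$P$-epic if, for all $r,s:A\to B$ in $\mathcal{A}$, $Pr\cdot q\le Ps\cdot q$ implies $r\le s$. $P$ is strongly order-solid if for every family $D$ of $\mathcal{A}$-objects and every family $\xi:PD\to X$ in $\mathcal{X}$ there are a family $\alpha:D\to A$ in $\mathcal{A}$ and a morphism $q:X\to PA$ such that: 1. $P\alpha=q\cdot\xi$; 2. for every family $\beta:D\to B$ in $\mathcal{A}$ and every $f:X\to PB$ with $P\beta=f\cdot\xi$ there is a unique $t:A\to B$ in $\mathcal{A}$ with $t\cdot\alpha=\beta$ and $Pt\cdot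 q=f$; 3. $q$ is order-$P$-epic. $P$ is solid as an ordinary functor (solid in the ordinary sense) if for every such $D$ and $\xi$ there are $\alpha$ and $q$ satisfying 1 and 2. $P$ is order-faithful if $Pr\le Ps$ implies $r\le s$, for all $r,s:A\to B$ in $\mathcal{A}$. An inserter of a pair $r,s:A\to B$ in an ordered category is a morphism $u:U\to A$ with $r\cdot u\le s\cdot u$ such that every $v:V\to A$ with $r\cdot v\le s\cdot v$ factors (uniquely) as $v=u\cdot j$, and $u$ is order-monic: $u\cdot h\le u\cdot k$ implies $h\le k$. A category has inserters if every parallel pair has an inserter. $P$ preserves inserters if, whenever $u$ is an inserter of $r,s$ in $\mathcal{A}$, $Pu$ is an inserter of $Pr,Ps$ in $\mathcal{X}$. *)

theory Defs
  imports Main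
begin

section \<open>Ordered categories\<close>

record ('o, 'm) ordcat =
  Ob :: "'o set"
  Ar :: "'m set"
  src :: "'m \<Rightarrow> 'o"
  tgt :: "'m \<Rightarrow> 'o"
  ide :: "'o \<Rightarrow> 'm"
  cmp :: "'m \<Rightarrow> 'm \<Rightarrow> 'm"  (infixl \<open>\<cdot>\<index>\<close> 70)
  leq :: "'m \<Rightarrow> 'm \<Rightarrow> bool"  (infix \<open>\<sqsubseteq>\<index>\<close> 50)

definition hom :: "('o, 'm) ordcat \<Rightarrow> 'o \<Rightarrow> 'o \<Rightarrow> 'm set" where
  "hom C a b = {f \<in> Ar C. src C f = a \<and> tgt C f = b}"

text \<open>Composition is written in the usual order: g \<open>\<cdot>\<close> f means g after f. The values of the
  operations outside the carriers, and of the order on non-parallel arrows, are irrelevant.\<close>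

locale ordered_category =
  fixes C :: "('o, 'm) ordcat" (structure)
  assumes src_Ob: "f \<in> Ar C \<Longrightarrow> src C f \<in> Ob C"
    and tgt_Ob: "f \<in> Ar C \<Longrightarrow> tgt C f \<in> Ob C"
    and ide_hom: "a \<in> Ob C \<Longrightarrow> ide C a \<in> hom C a a"
    and cmp_hom: "\<lbrakk>f \<in> hom C a b; g \<in> hom C b c\<rbrakk> \<Longrightarrow> g \<cdot> f \<in> hom C a c"
    and cmp_ide_right: "f \<in> hom C a b \<Longrightarrow> f \<cdot> ide C a = f"
    and cmp_ide_left: "f \<in> hom C a b \<Longrightarrow> ide C b \<cdot> f = f"
    and cmp_assoc:
      "\<lbrakk>f \<in> hom C a b; g \<in> hom C b c; h \<in> hom C c d\<rbrakk> \<Longrightarrow> (h \<cdot> g) \<cdot> f = h \<cdot> (g \<cdot> f)"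
    and leq_refl: "reflp_on (hom C a b) (leq C)"
    and leq_trans: "transp_on (hom C a b) (leq C)"
    and leq_antisym: "antisymp_on (hom C a b) (leq C)"
    and cmp_mono_left:
      "\<lbrakk>f \<in> hom C a b; f' \<in> hom C a b; g \<in> hom C b c; f \<sqsubseteq> f'\<rbrakk> \<Longrightarrow> g \<cdot> f \<sqsubseteq> g \<cdot> f'"
    and cmp_mono_right:
      "\<lbrakk>f \<in> hom C a b; g \<in> hom C b c; g' \<in> hom C b c; g \<sqsubseteq> g'\<rbrakk> \<Longrightarrow> g \<cdot> f \<sqsubseteq> g' \<cdot> f"

record ('oa, 'ma, 'ox, 'mx) functor_data =
  obmap :: "'oa \<Rightarrow> 'ox"
  armap :: "'ma \<Rightarrow> 'mx"

locale ordered_functor = A: ordered_category A + X: ordered_category X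
  for A :: "('oa, 'ma) ordcat" and X :: "('ox, 'mx) ordcat"
  + fixes P :: "('oa, 'ma, 'ox, 'mx) functor_data"
  assumes obmap_Ob: "a \<in> Ob A \<Longrightarrow> obmap P a \<in> Ob X"
    and armap_hom: "f \<in> hom A a b \<Longrightarrow> armap P f \<in> hom X (obmap P a) (obmap P b)"
    and armap_ide: "a \<in> Ob A \<Longrightarrow> armap P (ide A a) = ide X (obmap P a)"
    and armap_cmp: "\<lbrakk>f \<in> hom A a b; g \<in> hom A b c\<rbrakk>
          \<Longrightarrow> armap P (g \<cdot>\<^bsub>A\<^esub> f) = armap P g \<cdot>\<^bsub>X\<^esub> armap P f"
    and armap_mono: "\<lbrakk>f \<in> hom A a b; f' \<in> hom A a b; f \<sqsubseteq>\<^bsub>A\<^esub> f'\<rbrakk>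
          \<Longrightarrow> armap P f \<sqsubseteq>\<^bsub>X\<^esub> armap P f'"

definition order_faithful ::
    "('oa, 'ma) ordcat \<Rightarrow> ('ox, 'mx) ordcat \<Rightarrow> ('oa, 'ma, 'ox, 'mx) functor_data \<Rightarrow> bool" where
  "order_faithful A X P \<longleftrightarrow>
     (\<forall>a b r s. r \<in> hom A a b \<and> s \<in> hom A a b \<and> armap P r \<sqsubseteq>\<^bsub>X\<^esub> armap P s \<longrightarrow> r \<sqsubseteq>\<^bsub>A\<^esub> s)"

section \<open>Inserters\<close>

definition order_monic :: "('o, 'm) ordcat \<Rightarrow> 'm \<Rightarrow> bool" where
  "order_monic C u \<longleftrightarrow>
     (\<forall>v h k. h \<in> hom C v (src C u) \<and> k \<in> hom C v (src C u) \<and> u \<cdot>\<^bsub>C\<^esub> h \<sqsubseteq>\<^bsub>C\<^esub> u \<cdot>\<^bsub>C\<^esub> k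
        \<longrightarrow> h \<sqsubseteq>\<^bsub>C\<^esub> k)"

text \<open>To be used for parallel arrows r and s of C only.\<close>

definition is_inserter :: "('o, 'm) ordcat \<Rightarrow> 'm \<Rightarrow> 'm \<Rightarrow> 'm \<Rightarrow> bool" where
  "is_inserter C r s u \<longleftrightarrow>
     u \<in> Ar C \<and> tgt C u = src C r \<and> r \<cdot>\<^bsub>C\<^esub> u \<sqsubseteq>\<^bsub>C\<^esub> s \<cdot>\<^bsub>C\<^esub> u \<and>
     (\<forall>c v. v \<in> hom C c (src C r) \<and> r \<cdot>\<^bsub>C\<^esub> v \<sqsubseteq>\<^bsub>C\<^esub> s \<cdot>\<^bsub>C\<^esub> v
        \<longrightarrow> (\<exists>!j. j \<in> hom C c (src C u) \<and> v = u \<cdot>\<^bsub>C\<^esub> j)) \<and>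
     order_monic C u"

definition has_inserters :: "('o, 'm) ordcat \<Rightarrow> bool" where
  "has_inserters C \<longleftrightarrow>
     (\<forall>a b r s. r \<in> hom C a b \<and> s \<in> hom C a b \<longrightarrow> (\<exists>u. is_inserter C r s u))"

definition preserves_inserters ::
    "('oa, 'ma) ordcat \<Rightarrow> ('ox, 'mx) ordcat \<Rightarrow> ('oa, 'ma, 'ox, 'mx) functor_data \<Rightarrow> bool" where
  "preserves_inserters A X P \<longleftrightarrow>
     (\<forall>a b r s u. r \<in> hom A a b \<and> s \<in> hom A a b \<and> is_inserter A r s u
        \<longrightarrow> is_inserter X (armap P r) (armap P s) (armap P u))"

section \<open>Solid functors\<close>

text \<open>The index class of a family is an arbitrary (possibly empty) set I over an index type;
  a family of arrows with source family D and common target c is a function restricted to I.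
  Distinct indices may carry equal members.\<close>

definition family :: "('o, 'm) ordcat \<Rightarrow> 'i set \<Rightarrow> ('i \<Rightarrow> 'o) \<Rightarrow> 'o \<Rightarrow> ('i \<Rightarrow> 'm) \<Rightarrow> bool" where
  "family C I D c \<phi> \<longleftrightarrow> c \<in> Ob C \<and> (\<forall>i\<in>I. D i \<in> Ob C \<and> \<phi> i \<in> hom C (D i) c)"

definition order_P_epic ::
    "('oa, 'ma) ordcat \<Rightarrow> ('ox, 'mx) ordcat \<Rightarrow> ('oa, 'ma, 'ox, 'mx) functor_data
      \<Rightarrow> 'oa \<Rightarrow> 'mx \<Rightarrow> bool" where
  "order_P_epic A X P a q \<longleftrightarrow>
     (\<forall>b r s. r \<in> hom A a b \<and> s \<in> hom A a b \<and>
        armap P r \<cdot>\<^bsub>X\<^esub> q \<sqsubseteq>\<^bsub>X\<^esub> armap P s \<cdot>\<^bsub>X\<^esub> q \<longrightarrow> r \<sqsubseteq>\<^bsub>A\<^esub> s)"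

text \<open>The pair of \<open>\<alpha> : D \<rightarrow> a\<close> and \<open>q : x \<rightarrow> P a\<close> satisfies \<open>P \<alpha> = q \<cdot> \<xi>\<close> and is universal with
  this property.\<close>

definition solid_extension ::
    "('oa, 'ma) ordcat \<Rightarrow> ('ox, 'mx) ordcat \<Rightarrow> ('oa, 'ma, 'ox, 'mx) functor_data
      \<Rightarrow> 'i set \<Rightarrow> ('i \<Rightarrow> 'oa) \<Rightarrow> 'ox \<Rightarrow> ('i \<Rightarrow> 'mx) \<Rightarrow> 'oa \<Rightarrow> ('i \<Rightarrow> 'ma) \<Rightarrow> 'mx \<Rightarrow> bool" where
  "solid_extension A X P I D x \<xi> a \<alpha> q \<longleftrightarrow>
     family A I D a \<alpha> \<and> q \<in> hom X x (obmap P a) \<and>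
     (\<forall>i\<in>I. armap P (\<alpha> i) = q \<cdot>\<^bsub>X\<^esub> \<xi> i) \<and>
     (\<forall>b \<beta> f. family A I D b \<beta> \<and> f \<in> hom X x (obmap P b) \<and>
        (\<forall>i\<in>I. armap P (\<beta> i) = f \<cdot>\<^bsub>X\<^esub> \<xi> i)
        \<longrightarrow> (\<exists>!t. t \<in> hom A a b \<and> (\<forall>i\<in>I. t \<cdot>\<^bsub>A\<^esub> \<alpha> i = \<beta> i) \<and> armap P t \<cdot>\<^bsub>X\<^esub> q = f))"

text \<open>HOL cannot quantify over types inside a formula, so the type \<open>'i\<close> over which all index
  classes are formed is an explicit parameter. It has to be large enough for proper-class-sized
  families to be allowed; see \<open>large_index\<close> below.\<close>

definition solid ::
    "'i itself \<Rightarrow> ('oa, 'ma) ordcat \<Rightarrow> ('ox, 'mx) ordcat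
      \<Rightarrow> ('oa, 'ma, 'ox, 'mx) functor_data \<Rightarrow> bool" where
  "solid (ty :: 'i itself) A X P \<longleftrightarrow>
     (\<forall>(I :: 'i set) D x \<xi>. (\<forall>i\<in>I. D i \<in> Ob A) \<and> family X I (\<lambda>i. obmap P (D i)) x \<xi>
        \<longrightarrow> (\<exists>a \<alpha> q. solid_extension A X P I D x \<xi> a \<alpha> q))"

definition strongly_order_solid ::
    "'i itself \<Rightarrow> ('oa, 'ma) ordcat \<Rightarrow> ('ox, 'mx) ordcat
      \<Rightarrow> ('oa, 'ma, 'ox, 'mx) functor_data \<Rightarrow> bool" where
  "strongly_order_solid (ty :: 'i itself) A X P \<longleftrightarrow>
     (\<forall>(I :: 'i set) D x \<xi>. (\<forall>i\<in>I. D i \<in> Ob A) \<and> family X I (\<lambda>i. obmap P (D i)) x \<xi>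
        \<longrightarrow> (\<exists>a \<alpha> q. solid_extension A X P I D x \<xi> a \<alpha> q \<and> order_P_epic A X P a q))"

text \<open>Families may be as large as a proper class, so in particular the class of all arrows of A
  is (up to a bijection) an admissible index class. Any larger index type is covered as well.\<close>

definition large_index :: "'i itself \<Rightarrow> ('o, 'm) ordcat \<Rightarrow> bool" where
  "large_index (ty :: 'i itself) A \<longleftrightarrow> (\<exists>e :: 'm \<Rightarrow> 'i. inj_on e (Ar A))"

end

theory Submission
  imports Defs
begin

text \<open>
  Write \<open>(\<alpha>, q)\<close> for a universal extension of a family \<open>\<xi> : P D \<rightarrow> x\<close>. Everything rests on the
  rigidity of such extensions (\<open>solid_extension_endo\<close>): an endomorphism \<open>t\<close> of \<open>a\<close> with
  \<open>t \<cdot> \<alpha> = \<alpha>\<close> and \<open>P t \<cdot> q = q\<close> is the identity.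

  Suppose that \<open>P\<close> is solid, preserves the inserters of \<open>A\<close> and is order-faithful, and let
  \<open>P r \<cdot> q \<sqsubseteq> P s \<cdot> q\<close>. The inserter \<open>u\<close> of \<open>r, s\<close> is carried to an inserter, so \<open>q\<close> factors
  through \<open>P u\<close>; by order-faithfulness \<open>\<alpha>\<close> factors through \<open>u\<close> compatibly. Universality turns the
  two factorizations into an arrow \<open>t\<close>, which by rigidity splits \<open>u\<close>, and
  \<open>r = r \<cdot> u \<cdot> t \<sqsubseteq> s \<cdot> u \<cdot> t = s\<close>. Hence \<open>q\<close> is order-P-epic (\<open>solid_extension_epic\<close>).

  Suppose conversely that \<open>P\<close> is strongly order-solid. For a family that consists of one identity
  arrow, \<open>\<alpha>\<close> is invertible and \<open>q = P \<alpha>\<close>; that such a \<open>q\<close> is order-P-epic says that \<open>P\<close> is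
  order-faithful on the arrows out of that object (\<open>strongly_order_solid_faithful\<close>). To construct an inserter of \<open>r, s : a \<rightarrow> b\<close>, let
  \<open>w\<close> be an inserter of \<open>P r, P s\<close> and extend the family of the factorizations through \<open>w\<close> of all
  \<open>P d\<close>, where \<open>d\<close> runs through the class of all arrows into \<open>a\<close> with \<open>r \<cdot> d \<sqsubseteq> s \<cdot> d\<close>. Universality
  yields one arrow \<open>u\<close> through which all these \<open>d\<close> factor, and since \<open>q\<close> is order-P-epic, \<open>u\<close> is
  itself one of them. This self-reference makes \<open>q\<close> invertible, so \<open>P u\<close> is \<open>w\<close> up to an
  isomorphism, hence an inserter, and so is \<open>u\<close> by order-faithfulness
  (\<open>ex_preserved_inserter\<close>). As inserters are unique up to isomorphism, \<open>P\<close> then preserves all of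
  them.
\<close>

section \<open>Isomorphisms and inserters in an ordered category\<close>

definition inverse_arrows :: "('o, 'm) ordcat \<Rightarrow> 'o \<Rightarrow> 'o \<Rightarrow> 'm \<Rightarrow> 'm \<Rightarrow> bool" where
  "inverse_arrows C a b i i' \<longleftrightarrow> i \<in> hom C a b \<and> i' \<in> hom C b a \<and>
     i' \<cdot>\<^bsub>C\<^esub> i = ide C a \<and> i \<cdot>\<^bsub>C\<^esub> i' = ide C b"

lemma hom_src: "f \<in> hom C a b \<Longrightarrow> src C f = a"
  and hom_tgt: "f \<in> hom C a b \<Longrightarrow> tgt C f = b"
  and hom_Ar: "f \<in> hom C a b \<Longrightarrow> f \<in> Ar C"
  by (auto simp: hom_def)

lemma order_monicD:
  assumes "order_monic C u" "u \<in> hom C e a" "h \<in> hom C c e" "k \<in> hom C c e"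
    and "u \<cdot>\<^bsub>C\<^esub> h \<sqsubseteq>\<^bsub>C\<^esub> u \<cdot>\<^bsub>C\<^esub> k"
  shows "h \<sqsubseteq>\<^bsub>C\<^esub> k"
  using assms unfolding order_monic_def by (metis hom_src)

lemma inserter_hom:
  assumes "is_inserter C r s u" "r \<in> hom C a b"
  shows "u \<in> hom C (src C u) a"
  using assms by (auto simp: is_inserter_def hom_def)

lemma is_inserterD:
  assumes "is_inserter C r s u" "r \<in> hom C a b" "u \<in> hom C e a"
  shows "r \<cdot>\<^bsub>C\<^esub> u \<sqsubseteq>\<^bsub>C\<^esub> s \<cdot>\<^bsub>C\<^esub> u"
    "\<And>c v. v \<in> hom C c a \<Longrightarrow> r \<cdot>\<^bsub>C\<^esub> v \<sqsubseteq>\<^bsub>C\<^esub> s \<cdot>\<^bsub>C\<^esub> v \<Longrightarrow> \<exists>j\<in>hom C c e. v = u \<cdot>\<^bsub>C\<^esub> j"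
    "order_monic C u"
proof -
  have "src C r = a" "src C u = e" using assms by (simp_all add: hom_src)
  then show "r \<cdot>\<^bsub>C\<^esub> u \<sqsubseteq>\<^bsub>C\<^esub> s \<cdot>\<^bsub>C\<^esub> u" "order_monic C u"
    "\<And>c v. v \<in> hom C c a \<Longrightarrow> r \<cdot>\<^bsub>C\<^esub> v \<sqsubseteq>\<^bsub>C\<^esub> s \<cdot>\<^bsub>C\<^esub> v \<Longrightarrow> \<exists>j\<in>hom C c e. v = u \<cdot>\<^bsub>C\<^esub> j"
    using assms(1) unfolding is_inserter_def by blast+
qed

context ordered_category
begin

lemma hom_Ob: "f \<in> hom C a b \<Longrightarrow> a \<in> Ob C" "f \<in> hom C a b \<Longrightarrow> b \<in> Ob C"
  using src_Ob tgt_Ob by (auto simp: hom_def)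

lemma leq_reflD: "f \<in> hom C a b \<Longrightarrow> f \<sqsubseteq> f"
  using leq_refl by (auto simp: reflp_on_def)

lemma leq_antisymD: "f \<in> hom C a b \<Longrightarrow> g \<in> hom C a b \<Longrightarrow> f \<sqsubseteq> g \<Longrightarrow> g \<sqsubseteq> f \<Longrightarrow> f = g"
  using leq_antisym by (auto simp: antisymp_on_def)

text \<open>The uniqueness of the factorization is a consequence of \<open>u\<close> being order-monic, since the
  order is antisymmetric.\<close>

lemma is_inserterI:
  assumes r: "r \<in> hom C a b" and u: "u \<in> hom C e a" and le: "r \<cdot> u \<sqsubseteq> s \<cdot> u"
    and factor: "\<And>c v. v \<in> hom C c a \<Longrightarrow> r \<cdot> v \<sqsubseteq> s \<cdot> v \<Longrightarrow> \<exists>j\<in>hom C c e. v = u \<cdot> j"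
    and monic: "\<And>c h k. h \<in> hom C c e \<Longrightarrow> k \<in> hom C c e \<Longrightarrow> u \<cdot> h \<sqsubseteq> u \<cdot> k \<Longrightarrow> h \<sqsubseteq> k"
  shows "is_inserter C r s u"
proof -
  have "\<exists>!j. j \<in> hom C c e \<and> v = u \<cdot> j" if v: "v \<in> hom C c a" "r \<cdot> v \<sqsubseteq> s \<cdot> v" for c v
  proof -
    obtain j where j: "j \<in> hom C c e" "v = u \<cdot> j" using factor[OF v] by blast
    have "j' = j" if "j' \<in> hom C c e" "v = u \<cdot> j'" for j'
    proof -
      have "u \<cdot> j' \<sqsubseteq> u \<cdot> j" "u \<cdot> j \<sqsubseteq> u \<cdot> j'"
        using leq_reflD[OF v(1)] j that by auto
      then show ?thesis using monic j that leq_antisymD by blast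
    qed
    then show ?thesis using j by blast
  qed
  then show ?thesis
    using monic le hom_src[OF u] hom_src[OF r] hom_tgt[OF u] hom_Ar[OF u]
    unfolding is_inserter_def order_monic_def by auto
qed

lemma inserter_cmp_iso:
  assumes ins: "is_inserter C r s w" and r: "r \<in> hom C a b" and s: "s \<in> hom C a b"
    and w: "w \<in> hom C e a" and iso: "inverse_arrows C e' e i i'"
  shows "is_inserter C r s (w \<cdot> i)"
proof -
  have i: "i \<in> hom C e' e" and i': "i' \<in> hom C e e'"
    and i'i: "i' \<cdot> i = ide C e'" and ii': "i \<cdot> i' = ide C e"
    using iso by (auto simp: inverse_arrows_def)
  have le: "r \<cdot> w \<sqsubseteq> s \<cdot> w" and monic: "order_monic C w"
    and factor: "\<And>c v. v \<in> hom C c a \<Longrightarrow> r \<cdot> v \<sqsubseteq> s \<cdot> v \<Longrightarrow> \<exists>j\<in>hom C c e. v = w \<cdot> j"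
    using is_inserterD[OF ins r w] by blast+
  show ?thesis
  proof (rule is_inserterI[OF r])
    show "w \<cdot> i \<in> hom C e' a" using i w by (rule cmp_hom)
    have "(r \<cdot> w) \<cdot> i \<sqsubseteq> (s \<cdot> w) \<cdot> i"
      using cmp_mono_right i cmp_hom w r s le by blast
    then show "r \<cdot> (w \<cdot> i) \<sqsubseteq> s \<cdot> (w \<cdot> i)"
      using cmp_assoc i w r s by metis
  next
    fix c v
    assume "v \<in> hom C c a" "r \<cdot> v \<sqsubseteq> s \<cdot> v"
    then obtain j where j: "j \<in> hom C c e" "v = w \<cdot> j" using factor by blast
    have "(w \<cdot> i) \<cdot> (i' \<cdot> j) = w \<cdot> (i \<cdot> (i' \<cdot> j))"
      using cmp_assoc[OF cmp_hom[OF j(1) i'] i w] .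
    also have "i \<cdot> (i' \<cdot> j) = j"
      using cmp_assoc[OF j(1) i' i] ii' cmp_ide_left[OF j(1)] by simp
    finally show "\<exists>j\<in>hom C c e'. v = (w \<cdot> i) \<cdot> j"
      using j cmp_hom[OF j(1) i'] by metis
  next
    fix c h k
    assume h: "h \<in> hom C c e'" and k: "k \<in> hom C c e'" and "(w \<cdot> i) \<cdot> h \<sqsubseteq> (w \<cdot> i) \<cdot> k"
    then have "w \<cdot> (i \<cdot> h) \<sqsubseteq> w \<cdot> (i \<cdot> k)"
      using cmp_assoc[OF h i w] cmp_assoc[OF k i w] by simp
    then have "i \<cdot> h \<sqsubseteq> i \<cdot> k"
      using order_monicD[OF monic w] cmp_hom[OF h i] cmp_hom[OF k i] by blast
    then have "i' \<cdot> (i \<cdot> h) \<sqsubseteq> i' \<cdot> (i \<cdot> k)"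
      using cmp_mono_left cmp_hom[OF h i] cmp_hom[OF k i] i' by blast
    then show "h \<sqsubseteq> k"
      using cmp_assoc[OF h i i'] cmp_assoc[OF k i i'] i'i cmp_ide_left[OF h] cmp_ide_left[OF k]
      by simp
  qed
qed

lemma inserter_cancel:
  assumes "is_inserter C r s u" "r \<in> hom C a b" "s \<in> hom C a b" "u \<in> hom C e a"
    and "h \<in> hom C c e" "k \<in> hom C c e" "u \<cdot> h = u \<cdot> k"
  shows "h = k"
proof -
  have "order_monic C u" using assms(1) by (simp add: is_inserter_def)
  moreover have "u \<cdot> h \<sqsubseteq> u \<cdot> k" "u \<cdot> k \<sqsubseteq> u \<cdot> h"
    using leq_reflD[OF cmp_hom[OF assms(5,4)]] assms(7) by simp_all
  ultimately show ?thesis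
    using order_monicD[of C u e a] assms(4-6) leq_antisymD[OF assms(5,6)] by blast
qed

lemma inserter_unique:
  assumes u: "is_inserter C r s u" "u \<in> hom C e a" and v: "is_inserter C r s v" "v \<in> hom C e' a"
    and r: "r \<in> hom C a b" and s: "s \<in> hom C a b"
  obtains i i' where "inverse_arrows C e' e i i'" "v = u \<cdot> i"
proof -
  obtain i where i: "i \<in> hom C e' e" "v = u \<cdot> i"
    using is_inserterD(2)[OF u(1) r u(2) v(2) is_inserterD(1)[OF v(1) r v(2)]] by blast
  obtain i' where i': "i' \<in> hom C e e'" "u = v \<cdot> i'"
    using is_inserterD(2)[OF v(1) r v(2) u(2) is_inserterD(1)[OF u(1) r u(2)]] by blast
  have e: "ide C e \<in> hom C e e" "ide C e' \<in> hom C e' e'"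
    using ide_hom[OF hom_Ob(1)[OF u(2)]] ide_hom[OF hom_Ob(1)[OF v(2)]] .
  have "u \<cdot> (i \<cdot> i') = u \<cdot> ide C e"
    using cmp_assoc[OF i'(1) i(1) u(2)] i(2)[symmetric] i'(2)[symmetric] cmp_ide_right[OF u(2)] by simp
  then have "i \<cdot> i' = ide C e"
    using inserter_cancel[OF u(1) r s u(2)] cmp_hom[OF i'(1) i(1)] e by blast
  moreover have "v \<cdot> (i' \<cdot> i) = v \<cdot> ide C e'"
    using cmp_assoc[OF i(1) i'(1) v(2)] i(2)[symmetric] i'(2)[symmetric] cmp_ide_right[OF v(2)] by simp
  then have "i' \<cdot> i = ide C e'"
    using inserter_cancel[OF v(1) r s v(2)] cmp_hom[OF i(1) i'(1)] e by blast
  ultimately show thesis using that[OF _ i(2)] i(1) i'(1) by (simp add: inverse_arrows_def)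
qed

end

section \<open>Extensions of families along a functor\<close>

lemma order_faithfulD:
  assumes "order_faithful A X P" "r \<in> hom A a b" "s \<in> hom A a b" "armap P r \<sqsubseteq>\<^bsub>X\<^esub> armap P s"
  shows "r \<sqsubseteq>\<^bsub>A\<^esub> s"
  using assms by (auto simp: order_faithful_def)

lemma order_P_epicD:
  assumes "order_P_epic A X P a q" "r \<in> hom A a b" "s \<in> hom A a b"
    and "armap P r \<cdot>\<^bsub>X\<^esub> q \<sqsubseteq>\<^bsub>X\<^esub> armap P s \<cdot>\<^bsub>X\<^esub> q"
  shows "r \<sqsubseteq>\<^bsub>A\<^esub> s"
  using assms by (auto simp: order_P_epic_def)

lemma solid_extensionD:
  assumes "solid_extension A X P I D x \<xi> a \<alpha> q"
  shows "a \<in> Ob A" "\<And>i. i \<in> I \<Longrightarrow> \<alpha> i \<in> hom A (D i) a" "q \<in> hom X x (obmap P a)"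
    "\<And>i. i \<in> I \<Longrightarrow> armap P (\<alpha> i) = q \<cdot>\<^bsub>X\<^esub> \<xi> i"
  using assms by (auto simp: solid_extension_def family_def)

lemma solid_extension_universal:
  assumes "solid_extension A X P I D x \<xi> a \<alpha> q"
    and "b \<in> Ob A" "\<And>i. i \<in> I \<Longrightarrow> \<beta> i \<in> hom A (D i) b" "f \<in> hom X x (obmap P b)"
    and "\<And>i. i \<in> I \<Longrightarrow> armap P (\<beta> i) = f \<cdot>\<^bsub>X\<^esub> \<xi> i"
  shows "\<exists>!t. t \<in> hom A a b \<and> (\<forall>i\<in>I. t \<cdot>\<^bsub>A\<^esub> \<alpha> i = \<beta> i) \<and> armap P t \<cdot>\<^bsub>X\<^esub> q = f"
proof -
  have "family A I D b \<beta>"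
    using assms by (auto simp: solid_extension_def family_def)
  then show ?thesis
    using assms unfolding solid_extension_def by blast
qed

context ordered_functor
begin

lemma inverse_arrows_armap:
  assumes "inverse_arrows A a b i i'"
  shows "inverse_arrows X (obmap P a) (obmap P b) (armap P i) (armap P i')"
proof -
  have i: "i \<in> hom A a b" and i': "i' \<in> hom A b a"
    and "i' \<cdot>\<^bsub>A\<^esub> i = ide A a" "i \<cdot>\<^bsub>A\<^esub> i' = ide A b"
    using assms by (auto simp: inverse_arrows_def)
  then show ?thesis
    using armap_hom[OF i] armap_hom[OF i'] armap_cmp[OF i i'] armap_cmp[OF i' i]
      armap_ide[OF A.hom_Ob(1)[OF i]] armap_ide[OF A.hom_Ob(2)[OF i]]
    by (simp add: inverse_arrows_def)
qed

lemma faithful_eq: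
  assumes "order_faithful A X P" "r \<in> hom A a b" "s \<in> hom A a b" "armap P r = armap P s"
  shows "r = s"
proof (rule A.leq_antisymD[OF assms(2,3)])
  show "r \<sqsubseteq>\<^bsub>A\<^esub> s" "s \<sqsubseteq>\<^bsub>A\<^esub> r"
    using order_faithfulD[OF assms(1)] assms(2-4) X.leq_reflD[OF armap_hom[OF assms(2)]]
    by simp_all
qed

lemma solid_extension_endo:
  assumes ext: "solid_extension A X P I D x \<xi> a \<alpha> q" and t: "t \<in> hom A a a"
    and \<alpha>: "\<And>i. i \<in> I \<Longrightarrow> t \<cdot>\<^bsub>A\<^esub> \<alpha> i = \<alpha> i" and q: "armap P t \<cdot>\<^bsub>X\<^esub> q = q"
  shows "t = ide A a"
proof -
  note E = solid_extensionD[OF ext]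
  have "\<exists>!t. t \<in> hom A a a \<and> (\<forall>i\<in>I. t \<cdot>\<^bsub>A\<^esub> \<alpha> i = \<alpha> i) \<and> armap P t \<cdot>\<^bsub>X\<^esub> q = q"
    using solid_extension_universal[OF ext E] .
  moreover have "armap P (ide A a) \<cdot>\<^bsub>X\<^esub> q = q"
    using armap_ide[OF E(1)] X.cmp_ide_left[OF E(3)] by simp
  moreover have "ide A a \<cdot>\<^bsub>A\<^esub> \<alpha> i = \<alpha> i" if "i \<in> I" for i
    using A.cmp_ide_left[OF E(2)] that by blast
  ultimately show ?thesis using t \<alpha> q A.ide_hom[OF E(1)] by blast
qed

text \<open>An inserter \<open>u\<close> of \<open>r\<close> and \<open>s\<close> exists and is preserved. Rigidity of the extension splits it,
  and a split inserter forces \<open>r \<sqsubseteq> s\<close>.\<close>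

lemma solid_extension_epic:
  assumes ext: "solid_extension A X P I D x \<xi> a \<alpha> q"
    and \<xi>: "family X I (\<lambda>i. obmap P (D i)) x \<xi>"
    and ins: "has_inserters A" and pres: "preserves_inserters A X P"
    and faith: "order_faithful A X P"
  shows "order_P_epic A X P a q"
  unfolding order_P_epic_def
proof (intro allI impI, elim conjE)
  fix b r s
  assume r: "r \<in> hom A a b" and s: "s \<in> hom A a b"
    and le: "armap P r \<cdot>\<^bsub>X\<^esub> q \<sqsubseteq>\<^bsub>X\<^esub> armap P s \<cdot>\<^bsub>X\<^esub> q"
  note E = solid_extensionD[OF ext]
  note Pr = armap_hom[OF r] and Ps = armap_hom[OF s]
  have \<xi>i: "\<xi> i \<in> hom X (obmap P (D i)) x" if "i \<in> I" for i
    using \<xi> that by (simp add: family_def)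
  obtain u where insA: "is_inserter A r s u"
    using ins r s unfolding has_inserters_def by blast
  have insX: "is_inserter X (armap P r) (armap P s) (armap P u)"
    using pres r s insA by (auto simp: preserves_inserters_def)
  obtain e where u: "u \<in> hom A e a" using inserter_hom[OF insA r] by blast
  note ule = is_inserterD(1)[OF insA r u] and ufac = is_inserterD(2)[OF insA r u]
  note Pu = armap_hom[OF u]
  obtain j where j: "j \<in> hom X x (obmap P e)" "q = armap P u \<cdot>\<^bsub>X\<^esub> j"
    using is_inserterD(2)[OF insX Pr Pu E(3) le] by blast
  have "\<exists>g\<in>hom A (D i) e. \<alpha> i = u \<cdot>\<^bsub>A\<^esub> g" if i: "i \<in> I" for i
  proof (rule ufac[OF E(2)[OF i]])
    have "(armap P r \<cdot>\<^bsub>X\<^esub> q) \<cdot>\<^bsub>X\<^esub> \<xi> i \<sqsubseteq>\<^bsub>X\<^esub> (armap P s \<cdot>\<^bsub>X\<^esub> q) \<cdot>\<^bsub>X\<^esub> \<xi> i"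
      using X.cmp_mono_right[OF \<xi>i[OF i]] X.cmp_hom[OF E(3) Pr] X.cmp_hom[OF E(3) Ps] le by blast
    then have "armap P (r \<cdot>\<^bsub>A\<^esub> \<alpha> i) \<sqsubseteq>\<^bsub>X\<^esub> armap P (s \<cdot>\<^bsub>A\<^esub> \<alpha> i)"
      using armap_cmp[OF E(2)[OF i] r] armap_cmp[OF E(2)[OF i] s] E(4)[OF i]
        X.cmp_assoc[OF \<xi>i[OF i] E(3) Pr] X.cmp_assoc[OF \<xi>i[OF i] E(3) Ps] by simp
    then show "r \<cdot>\<^bsub>A\<^esub> \<alpha> i \<sqsubseteq>\<^bsub>A\<^esub> s \<cdot>\<^bsub>A\<^esub> \<alpha> i"
      using order_faithfulD[OF faith] A.cmp_hom[OF E(2)[OF i]] r s by blast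
  qed
  then obtain \<beta> where \<beta>: "\<And>i. i \<in> I \<Longrightarrow> \<beta> i \<in> hom A (D i) e" "\<And>i. i \<in> I \<Longrightarrow> \<alpha> i = u \<cdot>\<^bsub>A\<^esub> \<beta> i"
    by metis
  have P\<beta>: "armap P (\<beta> i) = j \<cdot>\<^bsub>X\<^esub> \<xi> i" if i: "i \<in> I" for i
  proof (rule X.inserter_cancel[OF insX Pr Ps Pu armap_hom[OF \<beta>(1)[OF i]]])
    show "j \<cdot>\<^bsub>X\<^esub> \<xi> i \<in> hom X (obmap P (D i)) (obmap P e)"
      using X.cmp_hom[OF \<xi>i[OF i] j(1)] .
    show "armap P u \<cdot>\<^bsub>X\<^esub> armap P (\<beta> i) = armap P u \<cdot>\<^bsub>X\<^esub> (j \<cdot>\<^bsub>X\<^esub> \<xi> i)"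
      using armap_cmp[OF \<beta>(1)[OF i] u] \<beta>(2)[OF i] E(4)[OF i] j(2)
        X.cmp_assoc[OF \<xi>i[OF i] j(1) Pu] by simp
  qed
  obtain t where t: "t \<in> hom A a e" "\<And>i. i \<in> I \<Longrightarrow> t \<cdot>\<^bsub>A\<^esub> \<alpha> i = \<beta> i" "armap P t \<cdot>\<^bsub>X\<^esub> q = j"
    using solid_extension_universal[OF ext A.hom_Ob(1)[OF u] \<beta>(1) j(1) P\<beta>] by blast
  have split: "u \<cdot>\<^bsub>A\<^esub> t = ide A a"
  proof (rule solid_extension_endo[OF ext A.cmp_hom[OF t(1) u]])
    show "(u \<cdot>\<^bsub>A\<^esub> t) \<cdot>\<^bsub>A\<^esub> \<alpha> i = \<alpha> i" if "i \<in> I" for i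
      using A.cmp_assoc[OF E(2)[OF that] t(1) u] t(2) \<beta>(2) that by simp
    show "armap P (u \<cdot>\<^bsub>A\<^esub> t) \<cdot>\<^bsub>X\<^esub> q = q"
      using X.cmp_assoc[OF E(3) armap_hom[OF t(1)] Pu] armap_cmp[OF t(1) u] t(3) j(2) by simp
  qed
  have "(r \<cdot>\<^bsub>A\<^esub> u) \<cdot>\<^bsub>A\<^esub> t \<sqsubseteq>\<^bsub>A\<^esub> (s \<cdot>\<^bsub>A\<^esub> u) \<cdot>\<^bsub>A\<^esub> t"
    using A.cmp_mono_right[OF t(1)] A.cmp_hom[OF u] r s ule by blast
  then show "r \<sqsubseteq>\<^bsub>A\<^esub> s"
    using A.cmp_assoc[OF t(1) u r] A.cmp_assoc[OF t(1) u s] split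
      A.cmp_ide_right[OF r] A.cmp_ide_right[OF s] by simp
qed

section \<open>Consequences of strong order-solidity\<close>

text \<open>Families may be indexed by any set that embeds into the given index type.\<close>

lemma strongly_order_solid_reindex:
  fixes J :: "'j set" and e :: "'j \<Rightarrow> 'i"
  assumes solid: "strongly_order_solid TYPE('i) A X P" and inj: "inj_on e J"
    and D: "\<And>j. j \<in> J \<Longrightarrow> D j \<in> Ob A" and \<xi>: "family X J (\<lambda>j. obmap P (D j)) x \<xi>"
  obtains a \<alpha> q where "solid_extension A X P J D x \<xi> a \<alpha> q" "order_P_epic A X P a q"
proof -
  define d where "d = inv_into J e"
  have d[simp]: "d (e j) = j" if "j \<in> J" for j using inj that by (simp add: d_def)
  have "\<forall>i\<in>e ` J. (D \<circ> d) i \<in> Ob A"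
    "family X (e ` J) (\<lambda>i. obmap P ((D \<circ> d) i)) x (\<xi> \<circ> d)"
    using D \<xi> by (auto simp: family_def)
  then have "\<exists>a \<alpha> q. solid_extension A X P (e ` J) (D \<circ> d) x (\<xi> \<circ> d) a \<alpha> q \<and>
      order_P_epic A X P a q"
    using solid[unfolded strongly_order_solid_def, rule_format, of "e ` J" "D \<circ> d" x "\<xi> \<circ> d"]
    by simp
  then obtain a \<alpha> q where ext: "solid_extension A X P (e ` J) (D \<circ> d) x (\<xi> \<circ> d) a \<alpha> q"
    and epic: "order_P_epic A X P a q"
    by blast
  note E = solid_extensionD[OF ext]
  have "\<exists>!t. t \<in> hom A a b \<and> (\<forall>j\<in>J. t \<cdot>\<^bsub>A\<^esub> (\<alpha> \<circ> e) j = \<beta> j) \<and> armap P t \<cdot>\<^bsub>X\<^esub> q = f"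
    if "family A J D b \<beta>" "f \<in> hom X x (obmap P b)"
      "\<forall>j\<in>J. armap P (\<beta> j) = f \<cdot>\<^bsub>X\<^esub> \<xi> j" for b \<beta> f
  proof -
    have "\<exists>!t. t \<in> hom A a b \<and> (\<forall>i\<in>e ` J. t \<cdot>\<^bsub>A\<^esub> \<alpha> i = (\<beta> \<circ> d) i) \<and> armap P t \<cdot>\<^bsub>X\<^esub> q = f"
      by (rule solid_extension_universal[OF ext]) (use that in \<open>auto simp: family_def\<close>)
    then show ?thesis by simp
  qed
  moreover have "family A J D a (\<alpha> \<circ> e)"
    using E(1) E(2) D by (force simp: family_def)
  moreover have "\<forall>j\<in>J. armap P ((\<alpha> \<circ> e) j) = q \<cdot>\<^bsub>X\<^esub> \<xi> j"
    using E(4) by force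
  ultimately have "solid_extension A X P J D x \<xi> a (\<alpha> \<circ> e) q"
    using E(3) unfolding solid_extension_def by blast
  then show thesis using that epic by blast
qed

text \<open>Extend the one-member family \<open>ide (P a)\<close>: the universal \<open>\<alpha> : a \<rightarrow> c\<close> satisfies \<open>P \<alpha> = q\<close> and has
  a left inverse \<open>t\<close> with \<open>P t \<cdot> q = ide\<close>, so \<open>P r \<sqsubseteq> P s\<close> reads
  \<open>P (r \<cdot> t) \<cdot> q \<sqsubseteq> P (s \<cdot> t) \<cdot> q\<close>. As \<open>q\<close> is order-P-epic, \<open>r \<cdot> t \<sqsubseteq> s \<cdot> t\<close>, and composition with \<open>\<alpha>\<close>
  removes \<open>t\<close>.\<close>

lemma strongly_order_solid_faithful:
  assumes solid: "strongly_order_solid TYPE('i) A X P"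
  shows "order_faithful A X P"
  unfolding order_faithful_def
proof (intro allI impI, elim conjE)
  fix a b r s
  assume r: "r \<in> hom A a b" and s: "s \<in> hom A a b" and le: "armap P r \<sqsubseteq>\<^bsub>X\<^esub> armap P s"
  note a = A.hom_Ob(1)[OF r]
  note Pa = obmap_Ob[OF a]
  note Pr = armap_hom[OF r] and Ps = armap_hom[OF s]
  have "family X {()} (\<lambda>_. obmap P a) (obmap P a) (\<lambda>_. ide X (obmap P a))"
    using Pa X.ide_hom[OF Pa] by (simp add: family_def)
  then obtain c \<alpha> q where
    ext: "solid_extension A X P {()} (\<lambda>_. a) (obmap P a) (\<lambda>_. ide X (obmap P a)) c \<alpha> q"
    and epic: "order_P_epic A X P c q"
    by (rule strongly_order_solid_reindex[OF solid, of "\<lambda>_. undefined" "{()}" "\<lambda>_. a", rotated 2])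
      (use a in auto)
  note E = solid_extensionD[OF ext]
  have \<alpha>: "\<alpha> () \<in> hom A a c" using E(2) by simp
  have "\<exists>!t. t \<in> hom A c a \<and> (\<forall>i\<in>{()}. t \<cdot>\<^bsub>A\<^esub> \<alpha> i = ide A a) \<and>
      armap P t \<cdot>\<^bsub>X\<^esub> q = ide X (obmap P a)"
    by (rule solid_extension_universal[OF ext a])
      (use A.ide_hom[OF a] X.ide_hom[OF Pa] armap_ide[OF a] X.cmp_ide_left in auto)
  then obtain t where t: "t \<in> hom A c a" "t \<cdot>\<^bsub>A\<^esub> \<alpha> () = ide A a"
      "armap P t \<cdot>\<^bsub>X\<^esub> q = ide X (obmap P a)"
    by blast
  have P: "armap P (g \<cdot>\<^bsub>A\<^esub> t) \<cdot>\<^bsub>X\<^esub> q = armap P g" if g: "g \<in> hom A a b" for g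
    using armap_cmp[OF t(1) g] X.cmp_assoc[OF E(3) armap_hom[OF t(1)] armap_hom[OF g]] t(3)
      X.cmp_ide_right[OF armap_hom[OF g]] by simp
  have cancel: "(g \<cdot>\<^bsub>A\<^esub> t) \<cdot>\<^bsub>A\<^esub> \<alpha> () = g" if g: "g \<in> hom A a b" for g
    using A.cmp_assoc[OF \<alpha> t(1) g] t(2) A.cmp_ide_right[OF g] by simp
  have rt: "r \<cdot>\<^bsub>A\<^esub> t \<in> hom A c b" and st: "s \<cdot>\<^bsub>A\<^esub> t \<in> hom A c b"
    using A.cmp_hom[OF t(1)] r s by auto
  have "r \<cdot>\<^bsub>A\<^esub> t \<sqsubseteq>\<^bsub>A\<^esub> s \<cdot>\<^bsub>A\<^esub> t"
    using order_P_epicD[OF epic rt st] P[OF r] P[OF s] le by simp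
  then show "r \<sqsubseteq>\<^bsub>A\<^esub> s"
    using A.cmp_mono_right[OF \<alpha> rt st] cancel[OF r] cancel[OF s] by simp
qed

text \<open>The family is indexed by all arrows \<open>d\<close> that an inserter has to factor. The arrow \<open>u\<close> obtained
  from it is among them, and its own member \<open>\<xi> u\<close> of the family is the inverse of \<open>q\<close>.\<close>

lemma ex_preserved_inserter:
  assumes solid: "strongly_order_solid TYPE('i) A X P" and large: "large_index TYPE('i) A"
    and insX: "has_inserters X" and r: "r \<in> hom A a b" and s: "s \<in> hom A a b"
  obtains u where "is_inserter A r s u" "is_inserter X (armap P r) (armap P s) (armap P u)"
proof -
  note faith = strongly_order_solid_faithful[OF solid]
  note Pr = armap_hom[OF r] and Ps = armap_hom[OF s] and a = A.hom_Ob(1)[OF r]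
  obtain w where wins: "is_inserter X (armap P r) (armap P s) w"
    using insX Pr Ps unfolding has_inserters_def by blast
  obtain x where w: "w \<in> hom X x (obmap P a)" using inserter_hom[OF wins Pr] by blast
  note wle = is_inserterD(1)[OF wins Pr w] and wfac = is_inserterD(2)[OF wins Pr w]
  define J where "J = {d \<in> Ar A. tgt A d = a \<and> r \<cdot>\<^bsub>A\<^esub> d \<sqsubseteq>\<^bsub>A\<^esub> s \<cdot>\<^bsub>A\<^esub> d}"
  have J: "d \<in> hom A (src A d) a" "r \<cdot>\<^bsub>A\<^esub> d \<sqsubseteq>\<^bsub>A\<^esub> s \<cdot>\<^bsub>A\<^esub> d" if "d \<in> J" for d
    using that by (auto simp: J_def hom_def)
  have JI: "d \<in> J" if "d \<in> hom A c a" "r \<cdot>\<^bsub>A\<^esub> d \<sqsubseteq>\<^bsub>A\<^esub> s \<cdot>\<^bsub>A\<^esub> d" for c d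
    using that by (auto simp: J_def hom_def)
  obtain e :: "'ma \<Rightarrow> 'i" where "inj_on e (Ar A)"
    using large by (auto simp: large_index_def)
  then have inj: "inj_on e J" by (rule inj_on_subset) (auto simp: J_def)
  have "\<exists>j\<in>hom X (obmap P (src A d)) x. armap P d = w \<cdot>\<^bsub>X\<^esub> j" if d: "d \<in> J" for d
  proof (rule wfac[OF armap_hom[OF J(1)[OF d]]])
    have "armap P (r \<cdot>\<^bsub>A\<^esub> d) \<sqsubseteq>\<^bsub>X\<^esub> armap P (s \<cdot>\<^bsub>A\<^esub> d)"
      using armap_mono A.cmp_hom[OF J(1)[OF d]] r s J(2)[OF d] by blast
    then show "armap P r \<cdot>\<^bsub>X\<^esub> armap P d \<sqsubseteq>\<^bsub>X\<^esub> armap P s \<cdot>\<^bsub>X\<^esub> armap P d"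
      using armap_cmp[OF J(1)[OF d]] r s by metis
  qed
  then obtain \<xi> where \<xi>: "\<And>d. d \<in> J \<Longrightarrow> \<xi> d \<in> hom X (obmap P (src A d)) x"
    and w\<xi>: "\<And>d. d \<in> J \<Longrightarrow> armap P d = w \<cdot>\<^bsub>X\<^esub> \<xi> d"
    by metis
  have D: "src A d \<in> Ob A" if "d \<in> J" for d using A.hom_Ob(1)[OF J(1)[OF that]] .
  have fam: "family X J (\<lambda>d. obmap P (src A d)) x \<xi>"
    using \<xi> X.hom_Ob(1)[OF w] D obmap_Ob by (simp add: family_def)
  obtain c \<alpha> q where ext: "solid_extension A X P J (src A) x \<xi> c \<alpha> q"
    and epic: "order_P_epic A X P c q"
    by (rule strongly_order_solid_reindex[OF solid inj D fam])
  note E = solid_extensionD[OF ext]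
  obtain u where u: "u \<in> hom A c a" "\<And>d. d \<in> J \<Longrightarrow> u \<cdot>\<^bsub>A\<^esub> \<alpha> d = d" "armap P u \<cdot>\<^bsub>X\<^esub> q = w"
    using solid_extension_universal[OF ext a J(1) w w\<xi>] by blast
  note Pu = armap_hom[OF u(1)]
  have Pgu: "armap P (g \<cdot>\<^bsub>A\<^esub> u) \<cdot>\<^bsub>X\<^esub> q = armap P g \<cdot>\<^bsub>X\<^esub> w" if g: "g \<in> hom A a b" for g
    using armap_cmp[OF u(1) g] X.cmp_assoc[OF E(3) Pu armap_hom[OF g]] u(3) by simp
  have ule: "r \<cdot>\<^bsub>A\<^esub> u \<sqsubseteq>\<^bsub>A\<^esub> s \<cdot>\<^bsub>A\<^esub> u"
    by (rule order_P_epicD[OF epic A.cmp_hom[OF u(1) r] A.cmp_hom[OF u(1) s]])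
      (simp add: Pgu r s wle)
  then have uJ: "u \<in> J" using JI u(1) by blast
  have srcu: "src A u = c" using u(1) by (rule hom_src)
  have \<xi>u: "\<xi> u \<in> hom X (obmap P c) x" using \<xi>[OF uJ] srcu by simp
  have \<alpha>u: "\<alpha> u \<in> hom A c c" using E(2)[OF uJ] srcu by simp
  have ide_x: "\<xi> u \<cdot>\<^bsub>X\<^esub> q = ide X x"
  proof (rule X.inserter_cancel[OF wins Pr Ps w X.cmp_hom[OF E(3) \<xi>u]])
    show "ide X x \<in> hom X x x" using X.ide_hom X.hom_Ob(1)[OF w] .
    show "w \<cdot>\<^bsub>X\<^esub> (\<xi> u \<cdot>\<^bsub>X\<^esub> q) = w \<cdot>\<^bsub>X\<^esub> ide X x"
      using X.cmp_assoc[OF E(3) \<xi>u w] w\<xi>[OF uJ] u(3) X.cmp_ide_right[OF w] by simp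
  qed
  (* q composed with \<xi> u is P (\<alpha> u), so q is inverse to \<xi> u as soon as \<alpha> u is an identity arrow. *)
  have q\<xi>q: "armap P (\<alpha> u) \<cdot>\<^bsub>X\<^esub> q = q"
    using E(4)[OF uJ] X.cmp_assoc[OF E(3) \<xi>u E(3)] ide_x X.cmp_ide_right[OF E(3)] by simp
  have "\<alpha> u = ide A c"
  proof (rule solid_extension_endo[OF ext \<alpha>u _ q\<xi>q])
    fix d assume d: "d \<in> J"
    have "armap P (\<alpha> u \<cdot>\<^bsub>A\<^esub> \<alpha> d) = armap P (\<alpha> d)"
      using armap_cmp[OF E(2)[OF d] \<alpha>u] E(4)[OF d] q\<xi>q
        X.cmp_assoc[OF \<xi>[OF d] E(3) armap_hom[OF \<alpha>u]] by simp
    then show "\<alpha> u \<cdot>\<^bsub>A\<^esub> \<alpha> d = \<alpha> d"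
      using faithful_eq[OF faith A.cmp_hom[OF E(2)[OF d] \<alpha>u] E(2)[OF d]] by blast
  qed
  then have "q \<cdot>\<^bsub>X\<^esub> \<xi> u = ide X (obmap P c)"
    using E(4)[OF uJ] armap_ide[OF E(1)] by simp
  then have "inverse_arrows X (obmap P c) x (\<xi> u) q"
    using ide_x \<xi>u E(3) by (simp add: inverse_arrows_def)
  then have Puins: "is_inserter X (armap P r) (armap P s) (armap P u)"
    using X.inserter_cmp_iso[OF wins Pr Ps w] w\<xi>[OF uJ] by simp
  have "is_inserter A r s u"
  proof (rule A.is_inserterI[OF r u(1) ule])
    fix c' v
    assume v: "v \<in> hom A c' a" "r \<cdot>\<^bsub>A\<^esub> v \<sqsubseteq>\<^bsub>A\<^esub> s \<cdot>\<^bsub>A\<^esub> v"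
    then show "\<exists>j\<in>hom A c' c. v = u \<cdot>\<^bsub>A\<^esub> j"
      using E(2) u(2) JI[OF v] hom_src[OF v(1)] by metis
  next
    fix c' h k
    assume h: "h \<in> hom A c' c" and k: "k \<in> hom A c' c" and le: "u \<cdot>\<^bsub>A\<^esub> h \<sqsubseteq>\<^bsub>A\<^esub> u \<cdot>\<^bsub>A\<^esub> k"
    have "armap P (u \<cdot>\<^bsub>A\<^esub> h) \<sqsubseteq>\<^bsub>X\<^esub> armap P (u \<cdot>\<^bsub>A\<^esub> k)"
      using armap_mono[OF A.cmp_hom[OF h u(1)] A.cmp_hom[OF k u(1)] le] .
    then have "armap P u \<cdot>\<^bsub>X\<^esub> armap P h \<sqsubseteq>\<^bsub>X\<^esub> armap P u \<cdot>\<^bsub>X\<^esub> armap P k"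
      using armap_cmp[OF h u(1)] armap_cmp[OF k u(1)] by simp
    moreover have "order_monic X (armap P u)" using Puins by (simp add: is_inserter_def)
    ultimately have "armap P h \<sqsubseteq>\<^bsub>X\<^esub> armap P k"
      using order_monicD[OF _ Pu armap_hom[OF h] armap_hom[OF k]] by blast
    then show "h \<sqsubseteq>\<^bsub>A\<^esub> k" using order_faithfulD[OF faith h k] by blast
  qed
  then show thesis using that Puins by blast
qed

lemma preserves_inserters_if_ex:
  assumes ex: "\<And>a b r s. r \<in> hom A a b \<Longrightarrow> s \<in> hom A a b \<Longrightarrow>
    \<exists>u. is_inserter A r s u \<and> is_inserter X (armap P r) (armap P s) (armap P u)"
  shows "preserves_inserters A X P"
  unfolding preserves_inserters_def
proof (intro allI impI, elim conjE)
  fix a b r s v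
  assume r: "r \<in> hom A a b" and s: "s \<in> hom A a b" and v: "is_inserter A r s v"
  obtain u where u: "is_inserter A r s u"
    and Puins: "is_inserter X (armap P r) (armap P s) (armap P u)"
    using ex[OF r s] by blast
  obtain c where uh: "u \<in> hom A c a" using inserter_hom[OF u r] by blast
  obtain c' where vh: "v \<in> hom A c' a" using inserter_hom[OF v r] by blast
  obtain i i' where i: "inverse_arrows A c' c i i'" "v = u \<cdot>\<^bsub>A\<^esub> i"
    using A.inserter_unique[OF u uh v vh r s] by blast
  then have "i \<in> hom A c' c" by (simp add: inverse_arrows_def)
  then have "armap P v = armap P u \<cdot>\<^bsub>X\<^esub> armap P i"
    using armap_cmp[OF _ uh] i(2) by blast
  then show "is_inserter X (armap P r) (armap P s) (armap P v)"
    using X.inserter_cmp_iso[OF Puins armap_hom[OF r] armap_hom[OF s] armap_hom[OF uh]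
        inverse_arrows_armap[OF i(1)]] by simp
qed

end

section \<open>The characterization\<close>

theorem theorem2p6:
  fixes A :: "('oa, 'ma) ordcat" and X :: "('ox, 'mx) ordcat"
    and P :: "('oa, 'ma, 'ox, 'mx) functor_data"
  assumes "ordered_functor A X P"
    and "has_inserters X"
    and "large_index TYPE('i) A"
  shows "strongly_order_solid TYPE('i) A X P \<longleftrightarrow>
           solid TYPE('i) A X P \<and>
           (has_inserters A \<and> preserves_inserters A X P) \<and>
           order_faithful A X P"
proof -
  interpret ordered_functor A X P by fact
  show ?thesis
  proof
    assume S: "strongly_order_solid TYPE('i) A X P"
    have ex: "\<exists>u. is_inserter A r s u \<and> is_inserter X (armap P r) (armap P s) (armap P u)"
      if "r \<in> hom A a b" "s \<in> hom A a b" for a b r s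
      using ex_preserved_inserter[OF S assms(3,2) that] by blast
    have "solid TYPE('i) A X P"
      unfolding solid_def
    proof (intro allI impI)
      fix K :: "'i set" and D x \<xi>
      assume "(\<forall>i\<in>K. D i \<in> Ob A) \<and> family X K (\<lambda>i. obmap P (D i)) x \<xi>"
      from S[unfolded strongly_order_solid_def, rule_format, OF this]
      show "\<exists>a \<alpha> q. solid_extension A X P K D x \<xi> a \<alpha> q" by blast
    qed
    moreover have "has_inserters A" using ex unfolding has_inserters_def by blast
    moreover have "preserves_inserters A X P" using ex by (rule preserves_inserters_if_ex)
    ultimately show "solid TYPE('i) A X P \<and> (has_inserters A \<and> preserves_inserters A X P) \<and>
        order_faithful A X P"
      using strongly_order_solid_faithful[OF S] by blast
  next
    assume "solid TYPE('i) A X P \<and> (has_inserters A \<and> preserves_inserters A X P) \<and>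
        order_faithful A X P"
    then have S: "solid TYPE('i) A X P" and I: "has_inserters A" "preserves_inserters A X P"
      and F: "order_faithful A X P"
      by blast+
    show "strongly_order_solid TYPE('i) A X P"
      unfolding strongly_order_solid_def
    proof (intro allI impI, elim conjE)
      fix K :: "'i set" and D x \<xi>
      assume "\<forall>i\<in>K. D i \<in> Ob A" and \<xi>: "family X K (\<lambda>i. obmap P (D i)) x \<xi>"
      from S[unfolded solid_def, rule_format, OF conjI, OF this]
      obtain a \<alpha> q where ext: "solid_extension A X P K D x \<xi> a \<alpha> q"
        by blast
      then show "\<exists>a \<alpha> q. solid_extension A X P K D x \<xi> a \<alpha> q \<and> order_P_epic A X P a q"
        using solid_extension_epic[OF ext \<xi> I F] by blast
    qed
  qed
qed

end
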